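(* Let $1<p<\infty$, and let $T$ be a monotone quasilinear operator on $\mathfrak{M}^+(0,\infty)$. Assume that $w\in\mathcal{W}(0,\infty)$ and that $v\in\mathcal{W}(0,\infty)$ is such that $$\int_0^x v^{1-p'}(t)\,dt<\infty,\qquad x\in(0,\infty).$$ Then the inequality $$\left\| T\left(\int_0^{x} h\right)\right\|_{\infty,w,(0,\infty)}\le C\,\|h\|_{p,v,(0,\infty)},\qquad h\in\mathfrak{M}^+(0,\infty),$$ holds if and only if the inequality $$\left\|\left(T\left(\left(\int_0^{x} h\right)^{\frac1p}\right)\right)^p\right\|_{\infty,w^p,(0,\infty)}\le C^p\,\|h\|_{1,\Phi^{1-2p},(0,\infty)},\qquad h\in\mathfrak{M}^+(0,\infty),$$ holds, where $$\Phi(x)=\left(\int_0^x v^{1-p'}(t)\,dt\right)^{\frac{1}{p'+1}},\qquad x\in(0,\infty).$$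
   Context: $\mathfrak{M}(0,\infty)$ is the set of measurable functions on $(0,\infty)$; $\mathfrak{M}^+(0,\infty)$ is the subset of functions non-negative on $(0,\infty)$; $\mathcal{W}(0,\infty)$ is the set of weights, i.e. measurable functions that are positive almost everywhere on $(0,\infty)$. For $p\in(1,\infty)$, $p'=p/(p-1)$. For $\omega\in\mathfrak{M}^+(0,\infty)$: $\|f\|_{s,\omega,(0,\infty)}=\left(\int_0^\infty |f(x)|^s\omega(x)\,dx\right)^{1/s}$ if $s\in(0,\infty)$, and $\|f\|_{\infty,\omega,(0,\infty)}=\operatorname{ess\,sup}_{x\in(0,\infty)}|f(x)|\,\omega(x)$. A monotone quasilinear operator on $\mathfrak{M}^+(0,\infty)$ is a map $T:\mathfrak{M}^+(0,\infty)\to\mathfrak{M}^+(0,\infty)$ such that: (i) $T(\lambda f)=\lambda Tf$ for all $\lambda\ge0$ and $f\in\mathfrak{M}^+(0,\infty)$; (ii) there is a constant $c>0$, independent of $f,g$, such that $Tf(x)\le c\,Tg(x)$ for almost all $x$ whenever $f(x)\le g(x)$ for almost all $x$; (iii) there is a constant $c>0$, independent of $f,g$, such that $T(f+g)\le c\,(Tf+Tg)$ for all $f,g\in\mathfrak{M}^+(0,\infty)$. In expressions such as $T\left(\int_0^x h\right)$ the operator $T$ acts on the function $x\mapsto\int_0^x h(t)\,dt$, and $T\left(\left(\int_0^x h\right)^{1/p}\right)$ is $T$ applied to $x\mapsto\left(\int_0^x h(t)\,dt\right)^{1/p}$. An inequality "holds" if there is a constant $C>0$, independent of $h$, for which it is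 valid for all indicated $h$; the constant $C$ may vary from one inequality to another. Conventions: $0\cdot\infty=0$, $\infty/\infty=0$, $0/0=0$. *)

theory Defs
  imports "HOL-Probability.Essential_Supremum"
begin

text \<open>
  Functions on \<open>(0,\<infinity>)\<close> are represented by functions on \<open>real\<close> of which only the values on
  \<open>{0<..}\<close> matter. Since integrals such as \<open>\<integral>\<^sub>0\<^sup>x h\<close> may be infinite, non-negative functions
  take values in \<open>[0,\<infinity>]\<close>. The arithmetic of \<open>ennreal\<close> has \<open>0 * \<infinity> = 0\<close>,
  \<open>\<infinity> / \<infinity> = 0\<close> and \<open>0 / 0 = 0\<close>.
\<close>

definition Mplus :: "(real \<Rightarrow> ennreal) set" where
  "Mplus = borel_measurable (lebesgue_on {0<..})"

definition weights :: "(real \<Rightarrow> ennreal) set" where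
  "weights = {w \<in> Mplus. AE x in lebesgue_on {0<..}. 0 < w x}"

text \<open>Real powers on \<open>[0,\<infinity>]\<close>. In contrast to \<open>powr\<close> on the reals, a negative power of
  \<open>0\<close> is \<open>\<infinity>\<close>.\<close>

definition ennpowr :: "ennreal \<Rightarrow> real \<Rightarrow> ennreal"  (infixr "powr\<^sub>e" 80) where
  "x powr\<^sub>e a =
     (if a = 0 then 1
      else if x = 0 then (if a < 0 then \<infinity> else 0)
      else if x = \<infinity> then (if a < 0 then 0 else \<infinity>)
      else ennreal (enn2real x powr a))"

definition conj_exp :: "real \<Rightarrow> real" where
  "conj_exp p = p / (p - 1)"

definition integral0 :: "(real \<Rightarrow> ennreal) \<Rightarrow> real \<Rightarrow> ennreal" where
  "integral0 h x = (\<integral>\<^sup>+t\<in>{0<..<x}. h t \<partial>lebesgue)"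

text \<open>The norms are only needed on non-negative functions, so no absolute value occurs.\<close>

definition wnorm :: "real \<Rightarrow> (real \<Rightarrow> ennreal) \<Rightarrow> (real \<Rightarrow> ennreal) \<Rightarrow> ennreal" where
  "wnorm s \<omega> f = (\<integral>\<^sup>+x. (f x powr\<^sub>e s) * \<omega> x \<partial>lebesgue_on {0<..}) powr\<^sub>e (1 / s)"

definition wnorm_inf :: "(real \<Rightarrow> ennreal) \<Rightarrow> (real \<Rightarrow> ennreal) \<Rightarrow> ennreal" where
  "wnorm_inf \<omega> f = esssup (lebesgue_on {0<..}) (\<lambda>x. f x * \<omega> x)"

text \<open>
  The second clause says that \<open>T\<close> really acts on functions on \<open>(0,\<infinity>)\<close>: the values of the
  representing functions outside \<open>{0<..}\<close> are irrelevant. The homogeneity and quasi-additivity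
  relations are, like the monotonicity one, required almost everywhere only; this covers both
  operators on functions and operators on equivalence classes of functions.
\<close>

definition monotone_quasilinear :: "((real \<Rightarrow> ennreal) \<Rightarrow> real \<Rightarrow> ennreal) \<Rightarrow> bool" where
  "monotone_quasilinear T \<longleftrightarrow>
     (\<forall>f\<in>Mplus. T f \<in> Mplus) \<and>
     (\<forall>f\<in>Mplus. \<forall>g\<in>Mplus. (\<forall>x>0. f x = g x) \<longrightarrow> (\<forall>x>0. T f x = T g x)) \<and>
     (\<forall>l::real. l \<ge> 0 \<longrightarrow> (\<forall>f\<in>Mplus.
        AE x in lebesgue_on {0<..}. T (\<lambda>y. ennreal l * f y) x = ennreal l * T f x)) \<and>
     (\<exists>c::real. c > 0 \<and> (\<forall>f\<in>Mplus. \<forall>g\<in>Mplus.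
        (AE x in lebesgue_on {0<..}. f x \<le> g x) \<longrightarrow>
        (AE x in lebesgue_on {0<..}. T f x \<le> ennreal c * T g x))) \<and>
     (\<exists>c::real. c > 0 \<and> (\<forall>f\<in>Mplus. \<forall>g\<in>Mplus.
        AE x in lebesgue_on {0<..}. T (\<lambda>y. f y + g y) x \<le> ennreal c * (T f x + T g x)))"

definition Phi :: "real \<Rightarrow> (real \<Rightarrow> ennreal) \<Rightarrow> real \<Rightarrow> ennreal" where
  "Phi p v x =
     (integral0 (\<lambda>t. v t powr\<^sub>e (1 - conj_exp p)) x) powr\<^sub>e (1 / (conj_exp p + 1))"

end

theory Submission
  imports Defs "HOL-Probability.Distribution_Functions"
begin

text \<open>
  Put \<open>\<rho> = v powr (1 - p')\<close> and \<open>V x = \<integral>\<^sub>0\<^sup>x \<rho>\<close>. The exponents in \<open>Phi\<close> are such that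
  \<open>Phi powr (1 - 2 p) = V powr (1 - p)\<close>, so after taking \<open>p\<close>-th roots the second inequality bounds
  \<open>T ((\<integral>\<^sub>0\<^sup>x h) powr (1/p))\<close> by \<open>(\<integral> h V powr (1 - p)) powr (1/p)\<close>. The operator \<open>T\<close> is dealt with by
  monotonicity and homogeneity: a pointwise bound \<open>F \<le> a G\<close> passes an inequality for \<open>T G\<close> on to
  \<open>T F\<close>. It is therefore enough to solve two problems that do not involve \<open>T\<close>, in
  each case for \<open>h\<close> with a finite norm.

  (1) Given \<open>h\<close>, find \<open>g\<close> with \<open>(\<integral>\<^sub>0\<^sup>x h) powr (1/p) \<le> const \<integral>\<^sub>0\<^sup>x g\<close> and
  \<open>\<integral> g powr p * v \<le> \<integral> h V powr (1 - p)\<close>. The choice \<open>g = \<rho> K powr (1/p)\<close> with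
  \<open>K t = \<integral>\<^sub>t\<^sup>\<infinity> h V powr (-p)\<close> works. Since \<open>\<rho> powr p * v = \<rho>\<close> almost everywhere, Tonelli's
  theorem gives the second property (\<open>integral_bound_by_tail_function\<close>). The first one is a reverse Minkowski inequality for the exponent \<open>1/p < 1\<close>; it is
  obtained from \<open>V powr p = p \<integral>\<^sub>0 \<rho> V powr (p - 1)\<close>, Tonelli's theorem and the monotonicity of \<open>K\<close>
  (\<open>integral0_le_tail_function\<close>).

  (2) Given \<open>h\<close>, find \<open>g\<close> with \<open>\<integral>\<^sub>0\<^sup>x h \<le> const (\<integral>\<^sub>0\<^sup>x g) powr (1/p)\<close> and
  \<open>\<integral> g V powr (1 - p) \<le> const \<integral> h powr p * v\<close>. Hoelder's inequality with the auxiliary weight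
  \<open>V powr b\<close>, \<open>b = (p - 1)/2\<close>, bounds \<open>(\<integral>\<^sub>0\<^sup>x h) powr p\<close> by a multiple of
  \<open>M x = V x powr b * \<integral>\<^sub>0\<^sup>x h powr p * v * V powr b\<close>. This \<open>M\<close> is increasing, and \<open>g\<close> is its derivative
  (\<open>integral0_le_Hardy\<close>, \<open>integral0_Hardy_function_ge\<close>); the
  bound on \<open>\<integral> g V powr (1 - p)\<close> is again Tonelli's theorem together with
  \<open>\<integral>\<^sub>s\<^sup>\<infinity> \<rho> V powr (-1-b) \<le> V s powr (-b) / b\<close> (\<open>integral_bound_by_Hardy_function\<close>). The same use of Hoelder's inequality
  with an auxiliary power, followed by Tonelli's theorem, is a classical proof of Hardy's inequality.

  Both parts need only the change of variable \<open>u = V t\<close>, \<open>du = \<rho> dt\<close> for a primitive \<open>V\<close> that is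
  merely continuous. It is the statement that a finite measure without atoms is transported by
  its distribution function to the Lebesgue measure of an interval (\<open>distr_cdf\<close>).
\<close>

section \<open>Powers of extended nonnegative reals\<close>

lemma ennreal_trichotomy:
  fixes x :: ennreal
  obtains "x = 0" | "x = top" | r where "0 < r" "x = ennreal r"
  by (cases x) (auto, metis less_eq_real_def)

lemma ennpowr_ennreal: "0 < r \<Longrightarrow> ennreal r powr\<^sub>e a = ennreal (r powr a)"
  by (auto simp: ennpowr_def)

lemma ennpowr_zero_pos [simp]: "0 < a \<Longrightarrow> 0 powr\<^sub>e a = 0"
  and ennpowr_zero_neg [simp]: "a < 0 \<Longrightarrow> 0 powr\<^sub>e a = top"
  and ennpowr_top_pos [simp]: "0 < a \<Longrightarrow> top powr\<^sub>e a = top"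
  and ennpowr_top_neg [simp]: "a < 0 \<Longrightarrow> top powr\<^sub>e a = 0"
  and ennpowr_exponent_zero [simp]: "x powr\<^sub>e 0 = 1"
  by (auto simp: ennpowr_def)

lemma ennpowr_exponent_one [simp]: "x powr\<^sub>e 1 = x"
  by (cases x rule: ennreal_trichotomy) (auto simp: ennpowr_ennreal)

lemma ennpowr_pos: "0 < a \<Longrightarrow> x \<noteq> 0 \<Longrightarrow> 0 < x powr\<^sub>e a"
  by (cases x rule: ennreal_trichotomy) (auto simp: ennpowr_ennreal)

lemma ennpowr_mult:
  assumes "0 < a"
  shows "(x * y) powr\<^sub>e a = x powr\<^sub>e a * y powr\<^sub>e a"
proof -
  have *: "ennreal r * top = top" "top * ennreal r = top" if "0 < r" for r
    using that by (auto simp: ennreal_mult_top ennreal_top_mult)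
  show ?thesis
    using assms
    by (cases x rule: ennreal_trichotomy; cases y rule: ennreal_trichotomy)
       (auto simp: ennpowr_ennreal * powr_mult simp flip: ennreal_mult)
qed

lemma ennpowr_ennpowr: "(x powr\<^sub>e a) powr\<^sub>e b = x powr\<^sub>e (a * b)"
  by (cases x rule: ennreal_trichotomy; cases a "0::real" rule: linorder_cases;
      cases b "0::real" rule: linorder_cases)
     (auto simp: ennpowr_ennreal powr_powr mult_neg_neg mult_pos_pos mult_neg_pos mult_pos_neg
       ennpowr_def[of 1])

lemma ennpowr_mono:
  assumes "0 < a" "x \<le> y"
  shows "x powr\<^sub>e a \<le> y powr\<^sub>e a"
  using assms
  by (cases x rule: ennreal_trichotomy; cases y rule: ennreal_trichotomy)
     (auto simp: ennpowr_ennreal powr_mono2 top_unique intro!: ennreal_leI)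

lemma ennpowr_le_iff:
  assumes "0 < a"
  shows "x powr\<^sub>e a \<le> y powr\<^sub>e a \<longleftrightarrow> x \<le> y"
proof
  assume "x powr\<^sub>e a \<le> y powr\<^sub>e a"
  from ennpowr_mono[OF _ this, of "1 / a"] assms show "x \<le> y"
    by (simp add: ennpowr_ennpowr)
qed (rule ennpowr_mono[OF assms])

lemma ennpowr_add:
  assumes "0 < a" "0 < b"
  shows "x powr\<^sub>e (a + b) = x powr\<^sub>e a * x powr\<^sub>e b"
  using assms
  by (cases x rule: ennreal_trichotomy)
     (auto simp: ennpowr_ennreal powr_add simp flip: ennreal_mult)

lemma ennpowr_add_finite:
  assumes "0 < x" "x < \<infinity>"
  shows "x powr\<^sub>e (a + b) = x powr\<^sub>e a * x powr\<^sub>e b"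
  using assms
  by (cases x rule: ennreal_trichotomy)
     (auto simp: ennpowr_ennreal powr_add simp flip: ennreal_mult)

text \<open>With \<open>0 * \<infinity> = 0\<close> the law of exponents is only an inequality at \<open>x = 0\<close>.\<close>

lemma ennpowr_mult_le_add:
  assumes "x < \<infinity>"
  shows "x powr\<^sub>e a * x powr\<^sub>e b \<le> x powr\<^sub>e (a + b)"
proof (cases "x = 0")
  case True
  then show ?thesis
    by (auto simp: ennpowr_def)
next
  case False
  then show ?thesis
    using ennpowr_add_finite[of x a b] assms by (simp add: zero_less_iff_neq_zero)
qed

lemma measurable_ennpowr [measurable]: "(\<lambda>x. x powr\<^sub>e a) \<in> borel_measurable borel"
  unfolding ennpowr_def by measurable

section \<open>The probability integral transform\<close>

text \<open>
  The measures agree on \<open>{u<..}\<close>: if \<open>t\<close> is the largest point with \<open>cdf M t \<le> u\<close>, then continuity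
  gives \<open>cdf M t = u\<close>, and \<open>{s. u < cdf M s} = {t<..}\<close> has mass \<open>measure M (space M) - u\<close>.
\<close>

lemma (in finite_borel_measure) distr_cdf:
  assumes atomless: "\<And>x. measure M {x} = 0"
  shows "distr M borel (cdf M) = density lborel (indicator {0<..<measure M (space M)})"
proof -
  define m where "m = measure M (space M)"
  have meas [measurable]: "cdf M \<in> borel_measurable M"
    using borel_measurable_mono[of "cdf M"] M_is_borel cdf_nondecreasing
    by (auto simp: mono_def cong: measurable_cong_sets)
  have cont: "isCont (cdf M) x" for x
    using atomless isCont_cdf by blast
  have lhs: "emeasure (distr M borel (cdf M)) {u<..} = emeasure M {t. u < cdf M t}" for u
    by (subst emeasure_distr) (auto simp: borel_UNIV vimage_def)
  have rhs: "emeasure (density lborel (indicator {0<..<m})) {u<..} = ennreal (m - max 0 u)"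
    for u
  proof -
    have "emeasure (density lborel (indicator {0<..<m})) {u<..}
        = (\<integral>\<^sup>+x. indicator {0<..<m} x * indicator {u<..} x \<partial>lborel)"
      by (rule emeasure_density) auto
    also have "\<dots> = (\<integral>\<^sup>+x. indicator {max 0 u<..<m} x \<partial>lborel)"
      by (intro nn_integral_cong) (auto split: split_indicator)
    finally show ?thesis
      by (cases "max 0 u \<le> m") (auto simp: ennreal_neg)
  qed
  have "emeasure M {t. u < cdf M t} = ennreal (m - max 0 u)" for u
  proof -
    consider "u < 0" | "m \<le> u" "0 \<le> u" | "0 \<le> u" "u < m" "{t. cdf M t \<le> u} = {}"
      | "0 \<le> u" "u < m" "{t. cdf M t \<le> u} \<noteq> {}" by force
    then show ?thesis
    proof cases
      case 1
      then have "{t. u < cdf M t} = space M"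
        using cdf_nonneg by (auto simp: borel_UNIV intro: less_le_trans)
      then show ?thesis
        using 1 by (simp add: m_def emeasure_eq_measure)
    next
      case 2
      then have "{t. u < cdf M t} = {}"
        using cdf_bounded by (auto simp: m_def not_less intro: order_trans)
      then show ?thesis
        using 2 by (simp add: ennreal_neg)
    next
      (* no point has cdf at most u, so the support is unbounded below and u must be 0 *)
      case 3
      then have *: "{t. u < cdf M t} = space M"
        by (auto simp: borel_UNIV not_le)
      have "u \<le> 0"
        using cdf_lim_at_bot
        by (rule tendsto_lowerbound) (use 3 in \<open>auto simp: eventually_at_bot_linorder not_le intro!: less_imp_le\<close>)
      then show ?thesis
        using * 3 by (simp add: m_def emeasure_eq_measure)
    next
      case 4
      define t where "t = Sup {t. cdf M t \<le> u}"
      have "eventually (\<lambda>s. u < cdf M s) at_top"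
        using order_tendstoD(1)[OF cdf_lim_at_top, of u] 4 by (simp add: m_def)
      then obtain b where b: "\<And>s. b \<le> s \<Longrightarrow> u < cdf M s"
        by (auto simp: eventually_at_top_linorder)
      have bdd: "bdd_above {t. cdf M t \<le> u}"
        using b by (intro bdd_aboveI[of _ b]) (meson linorder_not_less mem_Collect_eq nless_le)
      have "closed {t. cdf M t \<le> u}"
        by (intro closed_Collect_le continuous_at_imp_continuous_on ballI cont continuous_on_const)
      then have "t \<in> {t. cdf M t \<le> u}"
        unfolding t_def using 4 bdd by (intro closed_contains_Sup)
      then have le: "cdf M t \<le> u" by simp
      have gt: "u < cdf M s" if "t < s" for s
        using that bdd cSup_upper[of s "{t. cdf M t \<le> u}"]
        by (cases "u < cdf M s") (auto simp: t_def)
      have "u \<le> cdf M t"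
      proof (rule tendsto_lowerbound)
        show "(cdf M \<longlongrightarrow> cdf M t) (at_right t)"
          using cont[of t] by (auto simp: isCont_def intro: tendsto_within_subset)
        show "\<forall>\<^sub>F s in at_right t. u \<le> cdf M s"
          using gt by (auto simp: eventually_at_filter intro!: always_eventually less_imp_le)
      qed auto
      with le have eq: "cdf M t = u" by simp
      have set_eq: "{s. u < cdf M s} = space M - {..t}"
        using gt eq cdf_nondecreasing[of _ t] by (force simp: borel_UNIV not_le[symmetric])
      have "measure M (space M - {..t}) = m - u"
        using eq by (subst finite_measure_compl) (auto simp: m_def cdf_def)
      then show ?thesis
        using 4 set_eq by (simp add: emeasure_eq_measure)
    qed
  qed
  with lhs rhs show ?thesis
    by (intro measure_eqI_lessThan) (auto simp: m_def)
qed

section \<open>Tonelli's theorem and change of variable on the half-line\<close>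

abbreviation halfline :: "real measure" where
  "halfline \<equiv> lebesgue_on {0<..}"

text \<open>
  The adjoint of \<open>integral0\<close> with respect to the pairing \<open>\<integral> f g\<close>; see
  \<open>nn_integral_mult_integral0\<close>.
\<close>

definition tail_integral :: "(real \<Rightarrow> ennreal) \<Rightarrow> real \<Rightarrow> ennreal" where
  "tail_integral h x = (\<integral>\<^sup>+t. h t * indicator {x<..} t \<partial>halfline)"

lemma integral0_halfline: "integral0 h x = (\<integral>\<^sup>+t. h t * indicator {..<x} t \<partial>halfline)"
  unfolding integral0_def
  by (subst nn_integral_restrict_space) (auto intro!: nn_integral_cong split: split_indicator)

lemma integral0_nonpos: "x \<le> 0 \<Longrightarrow> integral0 h x = 0"
  by (auto simp: integral0_def)

lemma sigma_finite_lebesgue: "sigma_finite_measure (lebesgue :: real measure)"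
proof
  show "\<exists>A::real set set. countable A \<and> A \<subseteq> sets lebesgue \<and> \<Union>A = space lebesgue \<and>
      (\<forall>a\<in>A. emeasure lebesgue a \<noteq> \<infinity>)"
    by (intro exI[of _ "range (\<lambda>n::nat. {- real n <.. real n})"])
       (auto simp: UN_Ioc_eq_UNIV)
qed

interpretation halfline: sigma_finite_measure halfline
  by (rule sigma_finite_measure_restrict_space[OF sigma_finite_lebesgue]) auto

interpretation halfline: pair_sigma_finite halfline halfline ..

lemma borel_imp_halfline:
  assumes "f \<in> measurable borel N"
  shows "f \<in> measurable halfline N"
  using assms by (intro measurable_restrict_space1 measurable_completion) simp

lemma measurable_ident_halfline [measurable]: "(\<lambda>x. x) \<in> borel_measurable halfline"
  by (rule borel_imp_halfline) simp

lemma AE_halfline_neq: "AE t in halfline. t \<noteq> a"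
proof -
  have "AE t in lebesgue. t \<noteq> a"
    by (rule AE_completion) (rule AE_lborel_singleton)
  then show ?thesis
    by (subst AE_restrict_space_iff) auto
qed

lemma measurable_pred_halfline [measurable]:
  "Measurable.pred (halfline \<Otimes>\<^sub>M halfline) (\<lambda>z. snd z \<in> {..<fst z})"
  "Measurable.pred (halfline \<Otimes>\<^sub>M halfline) (\<lambda>z. snd z \<in> {fst z<..})"
  "Measurable.pred (halfline \<Otimes>\<^sub>M halfline) (\<lambda>z. fst z \<in> {..<snd z})"
  unfolding lessThan_iff greaterThan_iff by measurable

lemma measurable_integral0 [measurable]:
  assumes [measurable]: "h \<in> borel_measurable halfline"
  shows "integral0 h \<in> borel_measurable halfline"
proof -
  have "(\<lambda>x. \<integral>\<^sup>+t. h t * indicator {..<x} t \<partial>halfline) \<in> borel_measurable halfline"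
    by measurable
  then show ?thesis
    by (simp add: integral0_halfline[abs_def])
qed

lemma measurable_tail_integral [measurable]:
  assumes [measurable]: "h \<in> borel_measurable halfline"
  shows "tail_integral h \<in> borel_measurable halfline"
proof -
  have "(\<lambda>x. \<integral>\<^sup>+t. h t * indicator {x<..} t \<partial>halfline) \<in> borel_measurable halfline"
    by measurable
  then show ?thesis
    by (simp add: tail_integral_def[abs_def])
qed

lemma nn_integral_mult_integral0:
  assumes [measurable]: "a \<in> borel_measurable halfline" "k \<in> borel_measurable halfline"
  shows "(\<integral>\<^sup>+t. a t * integral0 k t \<partial>halfline) = (\<integral>\<^sup>+s. k s * tail_integral a s \<partial>halfline)"
proof -
  have "(\<integral>\<^sup>+t. a t * integral0 k t \<partial>halfline)
      = (\<integral>\<^sup>+t. (\<integral>\<^sup>+s. a t * k s * indicator {..<t} s \<partial>halfline) \<partial>halfline)"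
    by (simp add: integral0_halfline nn_integral_cmult[symmetric] mult.assoc)
  also have "\<dots> = (\<integral>\<^sup>+s. (\<integral>\<^sup>+t. a t * k s * indicator {..<t} s \<partial>halfline) \<partial>halfline)"
    by (rule halfline.Fubini') measurable
  also have "\<dots> = (\<integral>\<^sup>+s. (\<integral>\<^sup>+t. k s * (a t * indicator {s<..} t) \<partial>halfline) \<partial>halfline)"
    by (intro nn_integral_cong) (auto simp: mult_ac split: split_indicator)
  also have "\<dots> = (\<integral>\<^sup>+s. k s * tail_integral a s \<partial>halfline)"
    by (simp add: nn_integral_cmult tail_integral_def)
  finally show ?thesis .
qed

text \<open>
  The substitution \<open>u = \<integral>\<^sub>0\<^sup>t \<rho>\<close> without any regularity of \<open>\<rho>\<close>: on \<open>{..<x}\<close> the primitive is the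
  distribution function of the measure with density \<open>\<rho>\<close> restricted to \<open>{..<x}\<close>, to which the
  probability integral transform applies.
\<close>

lemma nn_integral_substitution_integral0:
  assumes [measurable]: "\<rho> \<in> borel_measurable halfline" "\<psi> \<in> borel_measurable borel"
    and fin: "\<And>x. 0 < x \<Longrightarrow> integral0 \<rho> x < \<infinity>" and "0 < x"
  shows "(\<integral>\<^sup>+t. \<rho> t * \<psi> (enn2real (integral0 \<rho> t)) * indicator {..<x} t \<partial>halfline)
       = (\<integral>\<^sup>+u. \<psi> u * indicator {0<..<enn2real (integral0 \<rho> x)} u \<partial>lborel)"
proof -
  define D where "D = density halfline (\<lambda>t. \<rho> t * indicator {..<x} t)"
  define N where "N = distr D borel (\<lambda>t. t)"
  have [measurable]: "(\<lambda>t. t) \<in> borel_measurable D"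
    by (simp add: D_def)
  have em: "emeasure N A = (\<integral>\<^sup>+t. \<rho> t * indicator {..<x} t * indicator A t \<partial>halfline)"
    if [measurable]: "A \<in> sets borel" for A
  proof -
    have "A \<inter> {0<..} \<in> sets halfline"
      using that by (auto simp: sets_restrict_space)
    then have "emeasure D (A \<inter> {0<..})
        = (\<integral>\<^sup>+t. \<rho> t * indicator {..<x} t * indicator (A \<inter> {0<..}) t \<partial>halfline)"
      unfolding D_def by (intro emeasure_density) measurable
    also have "\<dots> = (\<integral>\<^sup>+t. \<rho> t * indicator {..<x} t * indicator A t \<partial>halfline)"
      by (intro nn_integral_cong) (simp add: indicator_inter_arith)
    also have "emeasure D (A \<inter> {0<..}) = emeasure N A"
      unfolding N_def by (subst emeasure_distr) (auto simp: D_def)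
    finally show ?thesis .
  qed
  have nn_integral_N: "(\<integral>\<^sup>+t. f t \<partial>N) = (\<integral>\<^sup>+t. f t \<partial>D)" if "f \<in> borel_measurable borel" for f
    using that by (simp add: N_def nn_integral_distr)
  have mass: "emeasure N (space N) = integral0 \<rho> x"
    using em[of UNIV] by (simp add: N_def integral0_halfline)
  interpret N: finite_measure N
    by (rule finite_measureI) (use mass fin[OF \<open>0 < x\<close>] in simp)
  interpret N: finite_borel_measure N
    by unfold_locales (simp add: N_def)
  have atomless: "measure N {a} = 0" for a
  proof -
    have "emeasure N {a} = (\<integral>\<^sup>+t. 0 \<partial>halfline)"
      unfolding em[OF borel_singleton[OF sets.empty_sets]]
      by (intro nn_integral_cong_AE eventually_mono[OF AE_halfline_neq[of a]])
         (auto split: split_indicator)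
    then show ?thesis
      by (simp add: measure_def)
  qed
  have cdf: "cdf N t = enn2real (integral0 \<rho> t)" if "t \<le> x" for t
  proof -
    have "emeasure N {..t} = integral0 \<rho> t"
      unfolding integral0_halfline em[OF borel_closed[OF closed_atMost]]
      using that
      by (intro nn_integral_cong_AE eventually_mono[OF AE_halfline_neq[of t]])
         (auto split: split_indicator)
    then show ?thesis
      by (simp add: cdf_def measure_def)
  qed
  have [measurable]: "cdf N \<in> borel_measurable borel"
    by (intro borel_measurable_mono monoI N.cdf_nondecreasing)
  then have cdf_N: "cdf N \<in> borel_measurable N"
    using N.M_is_borel by (simp cong: measurable_cong_sets)
  have "(\<integral>\<^sup>+t. \<rho> t * \<psi> (enn2real (integral0 \<rho> t)) * indicator {..<x} t \<partial>halfline)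
      = (\<integral>\<^sup>+t. \<rho> t * indicator {..<x} t * \<psi> (cdf N t) \<partial>halfline)"
    using cdf by (intro nn_integral_cong) (auto split: split_indicator)
  also have "\<dots> = (\<integral>\<^sup>+t. \<psi> (cdf N t) \<partial>D)"
    unfolding D_def by (subst nn_integral_density) (auto intro: borel_imp_halfline)
  also have "\<dots> = (\<integral>\<^sup>+t. \<psi> (cdf N t) \<partial>N)"
    by (rule nn_integral_N[symmetric]) measurable
  also have "\<dots> = (\<integral>\<^sup>+u. \<psi> u \<partial>distr N borel (cdf N))"
    by (rule nn_integral_distr[symmetric, OF cdf_N]) simp
  also have "\<dots> = (\<integral>\<^sup>+u. \<psi> u * indicator {0<..<measure N (space N)} u \<partial>lborel)"
    by (subst N.distr_cdf[OF atomless], subst nn_integral_density) (auto simp: mult.commute)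
  also have "measure N (space N) = enn2real (integral0 \<rho> x)"
    using mass by (simp add: measure_def)
  finally show ?thesis .
qed

section \<open>Powers of a primitive\<close>

lemma nn_integral_powr_from_0:
  assumes "0 < q" "0 \<le> y"
  shows "(\<integral>\<^sup>+u. ennreal (q * u powr (q - 1)) * indicator {0<..<y} u \<partial>lborel) = ennreal (y powr q)"
proof -
  have "((\<lambda>u. q * u powr (q - 1)) has_integral y powr q) {0..y}"
    using has_integral_mult_right[OF has_integral_powr_from_0[of "q - 1" y], of q] assms by simp
  then have "(\<integral>\<^sup>+u. ennreal (indicator {0..y} u * (q * u powr (q - 1))) \<partial>lborel) = ennreal (y powr q)"
    using assms by (intro nn_integral_has_integral_lebesgue) auto
  moreover have "(\<integral>\<^sup>+u. ennreal (q * u powr (q - 1)) * indicator {0<..<y} u \<partial>lborel)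
      = (\<integral>\<^sup>+u. ennreal (indicator {0..y} u * (q * u powr (q - 1))) \<partial>lborel)"
    by (intro nn_integral_cong_AE eventually_mono[OF eventually_conj[OF
          AE_lborel_singleton[of 0] AE_lborel_singleton[of y]]])
       (auto split: split_indicator)
  ultimately show ?thesis by simp
qed

lemma nn_integral_powr_to_inf:
  assumes "0 < b" "0 < a"
  shows "(\<integral>\<^sup>+u. ennreal (b * u powr (- 1 - b)) * indicator {a..} u \<partial>lborel) = ennreal (a powr - b)"
proof -
  have "((\<lambda>u. b * u powr (- 1 - b)) has_integral a powr - b) {a..}"
    using has_integral_mult_right[OF has_integral_powr_to_inf[of "- 1 - b" a], of b] assms by simp
  then have "(\<integral>\<^sup>+u. ennreal (indicator {a..} u * (b * u powr (- 1 - b))) \<partial>lborel) = ennreal (a powr - b)"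
    using assms by (intro nn_integral_has_integral_lebesgue) auto
  moreover have "(\<integral>\<^sup>+u. ennreal (b * u powr (- 1 - b)) * indicator {a..} u \<partial>lborel)
      = (\<integral>\<^sup>+u. ennreal (indicator {a..} u * (b * u powr (- 1 - b))) \<partial>lborel)"
    by (intro nn_integral_cong) (auto split: split_indicator)
  ultimately show ?thesis by simp
qed

lemma nn_integral_halfline_le:
  assumes [measurable]: "f \<in> borel_measurable halfline"
    and le: "\<And>x. 0 < x \<Longrightarrow> (\<integral>\<^sup>+t. f t * indicator {..<x} t \<partial>halfline) \<le> B"
  shows "(\<integral>\<^sup>+t. f t \<partial>halfline) \<le> B"
proof -
  have "(\<integral>\<^sup>+t. f t \<partial>halfline) = (\<integral>\<^sup>+t. (SUP n. f t * indicator {..<real (Suc n)} t) \<partial>halfline)"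
  proof (intro nn_integral_cong antisym)
    fix t
    obtain n where "t < real n" using reals_Archimedean2 by blast
    then show "f t \<le> (SUP n. f t * indicator {..<real (Suc n)} t)"
      by (intro SUP_upper2[of n]) (simp_all split: split_indicator)
    show "(SUP n. f t * indicator {..<real (Suc n)} t) \<le> f t"
      by (intro SUP_least) (auto split: split_indicator)
  qed
  also have "\<dots> = (SUP n. \<integral>\<^sup>+t. f t * indicator {..<real (Suc n)} t \<partial>halfline)"
  proof (rule nn_integral_monotone_convergence_SUP)
    show "incseq (\<lambda>n t. f t * indicator {..<real (Suc n)} t)"
      by (intro incseq_SucI le_funI mult_left_mono) (simp_all split: split_indicator)
  qed measurable
  also have "\<dots> \<le> B"
    by (intro SUP_least le) simp
  finally show ?thesis .
qed

locale locally_finite_density =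
  fixes \<rho> :: "real \<Rightarrow> ennreal"
  assumes density_measurable [measurable]: "\<rho> \<in> borel_measurable halfline"
    and finite_primitive: "\<And>x. 0 < x \<Longrightarrow> integral0 \<rho> x < \<infinity>"
begin

abbreviation V :: "real \<Rightarrow> ennreal" where "V \<equiv> integral0 \<rho>"

lemma V_less_top: "V x < \<infinity>"
  using finite_primitive[of x] integral0_nonpos[of x \<rho>] by (cases "0 < x") auto

lemma V_mono: "s \<le> t \<Longrightarrow> V s \<le> V t"
  unfolding integral0_halfline by (intro nn_integral_mono) (auto split: split_indicator)

lemma substitution:
  assumes [measurable]: "\<psi> \<in> borel_measurable borel" and "0 < x"
  shows "(\<integral>\<^sup>+t. \<rho> t * \<psi> (V t) * indicator {..<x} t \<partial>halfline)
       = (\<integral>\<^sup>+u. \<psi> (ennreal u) * indicator {0<..<enn2real (V x)} u \<partial>lborel)"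
proof -
  have "ennreal (enn2real (V t)) = V t" for t
    using V_less_top[of t] by simp
  then show ?thesis
    using nn_integral_substitution_integral0[of \<rho> "\<lambda>u. \<psi> (ennreal u)" x] finite_primitive assms(2)
    by simp
qed

text \<open>
  The fundamental theorem of calculus for \<open>V powr q\<close>, whose derivative is \<open>q \<rho> V powr (q - 1)\<close>.
\<close>

lemma integral0_power:
  assumes "0 < q"
  shows "ennreal q * integral0 (\<lambda>t. \<rho> t * V t powr\<^sub>e (q - 1)) x = V x powr\<^sub>e q"
proof (cases "0 < x")
  case False
  then show ?thesis
    using assms by (simp add: integral0_nonpos)
next
  case True
  define y where "y = enn2real (V x)"
  have y: "0 \<le> y" "V x = ennreal y"
    using V_less_top[of x] by (auto simp: y_def)
  have "ennreal q * integral0 (\<lambda>t. \<rho> t * V t powr\<^sub>e (q - 1)) x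
      = ennreal q * (\<integral>\<^sup>+u. ennreal u powr\<^sub>e (q - 1) * indicator {0<..<y} u \<partial>lborel)"
    unfolding integral0_halfline[of "\<lambda>t. \<rho> t * V t powr\<^sub>e (q - 1)"] y_def
    using True by (subst substitution) auto
  also have "\<dots> = (\<integral>\<^sup>+u. ennreal q * (ennreal u powr\<^sub>e (q - 1) * indicator {0<..<y} u) \<partial>lborel)"
    by (subst nn_integral_cmult) auto
  also have "\<dots> = (\<integral>\<^sup>+u. ennreal (q * u powr (q - 1)) * indicator {0<..<y} u \<partial>lborel)"
    using assms by (intro nn_integral_cong)
      (auto simp: ennpowr_ennreal ennreal_mult split: split_indicator)
  also have "\<dots> = ennreal (y powr q)"
    by (rule nn_integral_powr_from_0[OF assms y(1)])
  also have "\<dots> = V x powr\<^sub>e q"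
    using y assms by (cases "y = 0") (auto simp: ennpowr_ennreal)
  finally show ?thesis .
qed

text \<open>
  The analogue of \<open>integral0_power\<close> for a negative power. Equality fails when \<open>V\<close> stays bounded:
  the integral then misses the value of \<open>V powr (- b)\<close> at infinity.
\<close>

lemma tail_integral_power_le:
  assumes "0 < b"
  shows "ennreal b * tail_integral (\<lambda>t. \<rho> t * V t powr\<^sub>e (- 1 - b)) s \<le> V s powr\<^sub>e (- b)"
proof (cases "V s = 0")
  case True
  then show ?thesis using assms by simp
next
  case False
  define y where "y = enn2real (V s)"
  have y: "0 < y" "V s = ennreal y"
    using V_less_top[of s] False by (auto simp: y_def enn2real_positive_iff zero_less_iff_neq_zero)
  have "(\<integral>\<^sup>+t. ennreal b * (\<rho> t * V t powr\<^sub>e (- 1 - b) * indicator {s<..} t) \<partial>halfline) \<le> V s powr\<^sub>e (- b)"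
  proof (rule nn_integral_halfline_le)
    fix x :: real assume "0 < x"
    define \<psi> where "\<psi> u = ennreal b * (u powr\<^sub>e (- 1 - b) * indicator {ennreal y..} u)" for u
    have [measurable]: "\<psi> \<in> borel_measurable borel"
      unfolding \<psi>_def by measurable
    have "(\<integral>\<^sup>+t. ennreal b * (\<rho> t * V t powr\<^sub>e (- 1 - b) * indicator {s<..} t) * indicator {..<x} t \<partial>halfline)
        \<le> (\<integral>\<^sup>+t. \<rho> t * \<psi> (V t) * indicator {..<x} t \<partial>halfline)"
      using V_mono[of s] y(2)
      by (intro nn_integral_mono) (auto simp: \<psi>_def mult_ac split: split_indicator)
    also have "\<dots> = (\<integral>\<^sup>+u. \<psi> (ennreal u) * indicator {0<..<enn2real (V x)} u \<partial>lborel)"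
      using \<open>0 < x\<close> by (intro substitution) auto
    also have "\<dots> \<le> (\<integral>\<^sup>+u. ennreal (b * u powr (- 1 - b)) * indicator {y..} u \<partial>lborel)"
      using assms y(1) by (intro nn_integral_mono)
        (auto simp: \<psi>_def ennpowr_ennreal ennreal_mult ennreal_le_iff2 split: split_indicator)
    also have "\<dots> = V s powr\<^sub>e (- b)"
      using y assms by (simp add: nn_integral_powr_to_inf ennpowr_ennreal)
    finally show "(\<integral>\<^sup>+t. ennreal b * (\<rho> t * V t powr\<^sub>e (- 1 - b) * indicator {s<..} t) * indicator {..<x} t \<partial>halfline)
        \<le> V s powr\<^sub>e (- b)" .
  qed measurable
  then show ?thesis
    by (simp add: tail_integral_def nn_integral_cmult)
qed

lemma power_le_tail_integral:
  assumes "0 < b"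
  shows "V x powr\<^sub>e b \<le> V s powr\<^sub>e b
    + ennreal b * tail_integral (\<lambda>t. \<rho> t * V t powr\<^sub>e (b - 1) * indicator {..<x} t) s"
proof -
  let ?f = "\<lambda>t. \<rho> t * V t powr\<^sub>e (b - 1)"
  have "integral0 ?f x
      \<le> (\<integral>\<^sup>+t. ?f t * indicator {..<s} t + ?f t * indicator {..<x} t * indicator {s<..} t \<partial>halfline)"
    unfolding integral0_halfline[of ?f]
    by (intro nn_integral_mono_AE eventually_mono[OF AE_halfline_neq[of s]])
       (simp split: split_indicator)
  also have "\<dots> = integral0 ?f s + tail_integral (\<lambda>t. ?f t * indicator {..<x} t) s"
    unfolding integral0_halfline[of ?f] tail_integral_def by (intro nn_integral_add) measurable
  finally have "ennreal b * integral0 ?f x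
      \<le> ennreal b * (integral0 ?f s + tail_integral (\<lambda>t. ?f t * indicator {..<x} t) s)"
    by (rule mult_left_mono) simp
  then show ?thesis
    using integral0_power[OF assms] by (simp add: distrib_left)
qed

text \<open>
  The set where \<open>V\<close> vanishes is mapped by \<open>V\<close> to a single point, hence to a null set. The result
  disposes of an initial interval on which \<open>\<rho>\<close> vanishes; there negative powers of \<open>V\<close> are
  infinite and cannot be cancelled against positive ones.
\<close>

lemma density_null_where_primitive_null: "AE t in halfline. V t = 0 \<longrightarrow> \<rho> t = 0"
proof -
  have "(\<integral>\<^sup>+t. \<rho> t * indicator {0} (V t) \<partial>halfline) \<le> 0"
  proof (rule nn_integral_halfline_le)
    fix x :: real assume "0 < x"
    then have "(\<integral>\<^sup>+t. \<rho> t * indicator {0} (V t) * indicator {..<x} t \<partial>halfline)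
       = (\<integral>\<^sup>+u. indicator {0} (ennreal u) * indicator {0<..<enn2real (V x)} u \<partial>lborel)"
      by (intro substitution) auto
    also have "\<dots> = (\<integral>\<^sup>+u. 0 \<partial>(lborel :: real measure))"
      by (intro nn_integral_cong) (auto split: split_indicator)
    finally show "(\<integral>\<^sup>+t. \<rho> t * indicator {0} (V t) * indicator {..<x} t \<partial>halfline) \<le> 0"
      by simp
  qed measurable
  then have "(\<integral>\<^sup>+t. \<rho> t * indicator {0} (V t) \<partial>halfline) = 0" by simp
  then have "AE t in halfline. \<rho> t * indicator {0} (V t) = 0"
    by (subst (asm) nn_integral_0_iff_AE) measurable
  then show ?thesis
    by eventually_elim (auto split: split_indicator)
qed

end

section \<open>Replacing the root of a primitive by a primitive\<close>

locale hardy_weight =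
  fixes p :: real and v :: "real \<Rightarrow> ennreal"
  assumes p_gt_1: "1 < p"
    and weight_measurable [measurable]: "v \<in> borel_measurable halfline"
    and weight_pos: "AE t in halfline. 0 < v t"
    and dual_weight_finite: "\<And>x. 0 < x \<Longrightarrow> integral0 (\<lambda>t. v t powr\<^sub>e (1 - conj_exp p)) x < \<infinity>"
begin

text \<open>The dual weight of \<open>v\<close>, normalised by \<open>\<rho> powr p * v = \<rho>\<close> wherever \<open>0 < v < \<infinity>\<close>.\<close>

definition \<rho> :: "real \<Rightarrow> ennreal" where "\<rho> t = v t powr\<^sub>e (1 - conj_exp p)"

sublocale locally_finite_density \<rho>
  using dual_weight_finite by unfold_locales (auto simp: \<rho>_def[abs_def])

lemma dual_exponent: "1 - conj_exp p = - (1 / (p - 1))"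
  using p_gt_1 by (simp add: conj_exp_def field_simps)

lemma dual_weight_power_le: "\<rho> t powr\<^sub>e p * v t \<le> \<rho> t"
  using p_gt_1
proof (cases "v t" rule: ennreal_trichotomy)
  case (3 r)
  have *: "- (1 / (p - 1)) * p + 1 = - (1 / (p - 1))"
    using p_gt_1 by (simp add: field_simps)
  have "r powr (- (1 / (p - 1)) * p) * r = r powr - (1 / (p - 1))"
    using 3 powr_add[of r "- (1 / (p - 1)) * p" 1] unfolding * by simp
  then show ?thesis
    using 3 by (simp add: \<rho>_def dual_exponent ennpowr_ennreal powr_powr flip: ennreal_mult)
qed (auto simp: \<rho>_def dual_exponent)

text \<open>
  The function \<open>g\<close> superposes, in the sense of \<open>p\<close>-th powers, the optimal functions for the single
  jumps of \<open>\<integral>\<^sub>0\<^sup>x h\<close>: a unit mass of \<open>h\<close> at \<open>s\<close> contributes \<open>\<rho> / V s\<close> on \<open>(0,s)\<close>, which has integral 1.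
\<close>

lemma integral_bound_by_tail_function:
  fixes h :: "real \<Rightarrow> ennreal"
  defines "g \<equiv> \<lambda>t. \<rho> t * tail_integral (\<lambda>s. h s * V s powr\<^sub>e (- p)) t powr\<^sub>e (1 / p)"
  assumes [measurable]: "h \<in> borel_measurable halfline"
  shows "(\<integral>\<^sup>+t. g t powr\<^sub>e p * v t \<partial>halfline) \<le> (\<integral>\<^sup>+t. h t * V t powr\<^sub>e (1 - p) \<partial>halfline)"
proof -
  let ?k = "\<lambda>s. h s * V s powr\<^sub>e (- p)"
  have "g t powr\<^sub>e p * v t \<le> \<rho> t * tail_integral ?k t" for t
  proof -
    have "g t powr\<^sub>e p * v t = (\<rho> t powr\<^sub>e p * v t) * tail_integral ?k t"
      using p_gt_1 by (simp add: g_def ennpowr_mult ennpowr_ennpowr mult_ac)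
    also have "\<dots> \<le> \<rho> t * tail_integral ?k t"
      by (intro mult_right_mono dual_weight_power_le) simp
    finally show ?thesis .
  qed
  then have "(\<integral>\<^sup>+t. g t powr\<^sub>e p * v t \<partial>halfline) \<le> (\<integral>\<^sup>+t. \<rho> t * tail_integral ?k t \<partial>halfline)"
    by (intro nn_integral_mono)
  also have "\<dots> = (\<integral>\<^sup>+t. ?k t * V t \<partial>halfline)"
    by (rule nn_integral_mult_integral0[symmetric]) measurable
  also have "\<dots> \<le> (\<integral>\<^sup>+t. h t * V t powr\<^sub>e (1 - p) \<partial>halfline)"
  proof (intro nn_integral_mono)
    fix t
    show "?k t * V t \<le> h t * V t powr\<^sub>e (1 - p)"
      using mult_left_mono[OF ennpowr_mult_le_add[OF V_less_top[of t], of "- p" 1], of "h t"]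
      by (simp add: mult_ac)
  qed
  finally show ?thesis .
qed

text \<open>
  Writing \<open>h = h V powr (-p) * V powr p\<close> and \<open>V powr p = p \<integral>\<^sub>0 \<rho> V powr (p - 1)\<close>, Tonelli's theorem turns
  \<open>\<integral>\<^sub>0\<^sup>x h\<close> into \<open>p \<integral> \<rho> V powr (p - 1) K\<close>, where \<open>K\<close> is the tail integral of \<open>h V powr (-p)\<close> cut off at
  \<open>x\<close>. As \<open>K\<close> decreases, \<open>V t * K t powr (1/p)\<close> is at most \<open>\<integral>\<^sub>0\<^sup>t \<rho> K powr (1/p)\<close>, so that
  \<open>V powr (p - 1) K\<close> may be replaced by \<open>K powr (1/p)\<close> times the \<open>(p - 1)\<close>-th power of \<open>\<integral>\<^sub>0\<^sup>x g\<close>.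
\<close>

lemma integral0_le_tail_function:
  fixes h :: "real \<Rightarrow> ennreal"
  defines "g \<equiv> \<lambda>t. \<rho> t * tail_integral (\<lambda>s. h s * V s powr\<^sub>e (- p)) t powr\<^sub>e (1 / p)"
  assumes [measurable]: "h \<in> borel_measurable halfline"
    and fin: "(\<integral>\<^sup>+t. h t * V t powr\<^sub>e (1 - p) \<partial>halfline) < \<infinity>"
  shows "integral0 h x \<le> ennreal p * integral0 g x powr\<^sub>e p"
proof -
  let ?u = "\<lambda>s. h s * V s powr\<^sub>e (- p)"
  let ?k = "\<lambda>s. ?u s * indicator {..<x} s"
  define K where "K = tail_integral ?k"
  define G where "G = integral0 g x"
  have [measurable]: "K \<in> borel_measurable halfline"
    unfolding K_def by measurable
  have K_0: "K t = 0" if "x \<le> t" for t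
  proof -
    have "K t = (\<integral>\<^sup>+s. 0 \<partial>halfline)"
      unfolding K_def tail_integral_def
      using that by (intro nn_integral_cong) (simp split: split_indicator)
    then show ?thesis by simp
  qed
  have K_le: "K t \<le> tail_integral ?u s" if "s \<le> t" for s t
    unfolding K_def tail_integral_def
    using that by (intro nn_integral_mono) (simp split: split_indicator)
  have null: "AE t in halfline. V t = 0 \<longrightarrow> h t = 0"
  proof -
    have "AE t in halfline. h t * V t powr\<^sub>e (1 - p) \<noteq> \<infinity>"
      using fin by (intro nn_integral_noteq_infinite) auto
    then show ?thesis
      by eventually_elim (use p_gt_1 in \<open>auto simp: ennreal_mult_top split: if_splits\<close>)
  qed
  have K_bound: "V t * K t powr\<^sub>e (1 / p) \<le> G" for t
  proof (cases "t < x")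
    case False
    then show ?thesis
      using K_0 p_gt_1 by simp
  next
    case True
    have "V t * K t powr\<^sub>e (1 / p)
        = (\<integral>\<^sup>+s. \<rho> s * indicator {..<t} s * K t powr\<^sub>e (1 / p) \<partial>halfline)"
      by (simp add: integral0_halfline nn_integral_multc)
    also have "\<dots> \<le> (\<integral>\<^sup>+s. g s * indicator {..<x} s \<partial>halfline)"
      using True p_gt_1 K_le
      by (intro nn_integral_mono)
         (auto simp: g_def split: split_indicator intro!: mult_left_mono ennpowr_mono)
    also have "\<dots> = G"
      by (simp add: G_def integral0_halfline)
    finally show ?thesis .
  qed
  have "integral0 h x \<le> (\<integral>\<^sup>+t. ?k t * V t powr\<^sub>e p \<partial>halfline)"
    unfolding integral0_halfline[of h]
  proof (rule nn_integral_mono_AE, use null in eventually_elim)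
    fix t assume *: "V t = 0 \<longrightarrow> h t = 0"
    show "h t * indicator {..<x} t \<le> ?k t * V t powr\<^sub>e p"
    proof (cases "V t = 0")
      case False
      then have "V t powr\<^sub>e (- p) * V t powr\<^sub>e p = 1"
        using ennpowr_add_finite[of "V t" "- p" p] V_less_top[of t]
        by (simp add: zero_less_iff_neq_zero)
      then show ?thesis
        by (simp add: mult_ac split: split_indicator)
    qed (use * in simp)
  qed
  also have "\<dots> = (\<integral>\<^sup>+t. ennreal p * (?k t * integral0 (\<lambda>s. \<rho> s * V s powr\<^sub>e (p - 1)) t) \<partial>halfline)"
    using p_gt_1 by (intro nn_integral_cong) (simp add: integral0_power[of p, symmetric] mult_ac)
  also have "\<dots> = ennreal p * (\<integral>\<^sup>+t. ?k t * integral0 (\<lambda>s. \<rho> s * V s powr\<^sub>e (p - 1)) t \<partial>halfline)"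
    by (rule nn_integral_cmult) measurable
  also have "(\<integral>\<^sup>+t. ?k t * integral0 (\<lambda>s. \<rho> s * V s powr\<^sub>e (p - 1)) t \<partial>halfline)
      = (\<integral>\<^sup>+t. (\<rho> t * V t powr\<^sub>e (p - 1)) * K t \<partial>halfline)"
    unfolding K_def by (rule nn_integral_mult_integral0) measurable
  also have "\<dots> \<le> (\<integral>\<^sup>+t. (g t * indicator {..<x} t) * G powr\<^sub>e (p - 1) \<partial>halfline)"
  proof (intro nn_integral_mono)
    fix t
    have K_split: "K t = K t powr\<^sub>e (1 / p) * (K t powr\<^sub>e (1 / p)) powr\<^sub>e (p - 1)"
      using ennpowr_add[of "1 / p" "1 / p * (p - 1)" "K t"] p_gt_1
      by (simp add: ennpowr_ennpowr field_simps)
    have "(\<rho> t * V t powr\<^sub>e (p - 1)) * K t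
        = (\<rho> t * K t powr\<^sub>e (1 / p)) * (V t * K t powr\<^sub>e (1 / p)) powr\<^sub>e (p - 1)"
      by (subst K_split) (use p_gt_1 in \<open>simp add: ennpowr_mult mult_ac\<close>)
    also have "\<dots> \<le> (g t * indicator {..<x} t) * G powr\<^sub>e (p - 1)"
    proof (rule mult_mono)
      show "(V t * K t powr\<^sub>e (1 / p)) powr\<^sub>e (p - 1) \<le> G powr\<^sub>e (p - 1)"
        using p_gt_1 by (intro ennpowr_mono K_bound) simp
      show "\<rho> t * K t powr\<^sub>e (1 / p) \<le> g t * indicator {..<x} t"
        using K_0[of t] K_le[of t t] p_gt_1
        by (auto simp: g_def split: split_indicator intro!: mult_left_mono ennpowr_mono)
    qed (use p_gt_1 in auto)
    finally show "(\<rho> t * V t powr\<^sub>e (p - 1)) * K t \<le> (g t * indicator {..<x} t) * G powr\<^sub>e (p - 1)" .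
  qed
  also have "\<dots> = (\<integral>\<^sup>+t. g t * indicator {..<x} t \<partial>halfline) * G powr\<^sub>e (p - 1)"
    by (rule nn_integral_multc) (simp add: g_def)
  also have "\<dots> = G powr\<^sub>e p"
    using ennpowr_add[of 1 "p - 1" G] p_gt_1 by (simp add: G_def integral0_halfline)
  finally show ?thesis
    by (simp add: G_def mult_left_mono)
qed

section \<open>Replacing a primitive by the root of a primitive\<close>

text \<open>
  Here \<open>g\<close> is the derivative of \<open>V powr b * \<integral>\<^sub>0 k V powr b\<close> by the product rule. Multiplied by
  \<open>V powr (1 - p) = V powr (- 2 b)\<close> its first summand is at most \<open>k\<close>; the second one integrates to at most
  \<open>\<integral> k\<close> after an exchange of the order of integration.
\<close>

lemma integral_bound_by_Hardy_function:
  fixes h :: "real \<Rightarrow> ennreal"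
  defines "b \<equiv> (p - 1) / 2" and "k \<equiv> \<lambda>t. h t powr\<^sub>e p * v t"
  defines "g \<equiv> \<lambda>t. k t * V t powr\<^sub>e (2 * b)
    + ennreal b * (\<rho> t * V t powr\<^sub>e (b - 1) * integral0 (\<lambda>s. k s * V s powr\<^sub>e b) t)"
  assumes [measurable]: "h \<in> borel_measurable halfline"
  shows "(\<integral>\<^sup>+t. g t * V t powr\<^sub>e (1 - p) \<partial>halfline) \<le> 2 * (\<integral>\<^sup>+t. h t powr\<^sub>e p * v t \<partial>halfline)"
proof -
  have b: "0 < b" "1 - p = - (2 * b)"
    using p_gt_1 by (simp_all add: b_def field_simps)
  have [measurable]: "k \<in> borel_measurable halfline"
    unfolding k_def by measurable
  define J where "J = integral0 (\<lambda>s. k s * V s powr\<^sub>e b)"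
  have [measurable]: "J \<in> borel_measurable halfline"
    unfolding J_def by measurable
  have exps: "V t powr\<^sub>e (2 * b) * V t powr\<^sub>e (1 - p) \<le> 1"
      "V t powr\<^sub>e (b - 1) * V t powr\<^sub>e (1 - p) \<le> V t powr\<^sub>e (- 1 - b)"
      "V t powr\<^sub>e b * V t powr\<^sub>e (- b) \<le> 1" for t
    using ennpowr_mult_le_add[OF V_less_top[of t], of "2 * b" "1 - p"]
      ennpowr_mult_le_add[OF V_less_top[of t], of "b - 1" "1 - p"]
      ennpowr_mult_le_add[OF V_less_top[of t], of b "- b"]
    by (simp_all add: b(2) algebra_simps)
  have "(\<integral>\<^sup>+t. g t * V t powr\<^sub>e (1 - p) \<partial>halfline)
      \<le> (\<integral>\<^sup>+t. k t + ennreal b * (\<rho> t * V t powr\<^sub>e (- 1 - b) * J t) \<partial>halfline)"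
  proof (intro nn_integral_mono)
    fix t
    have "g t * V t powr\<^sub>e (1 - p) = k t * (V t powr\<^sub>e (2 * b) * V t powr\<^sub>e (1 - p))
        + ennreal b * (\<rho> t * (V t powr\<^sub>e (b - 1) * V t powr\<^sub>e (1 - p)) * J t)"
      by (simp add: g_def J_def distrib_left distrib_right mult_ac)
    also have "\<dots> \<le> k t * 1 + ennreal b * (\<rho> t * V t powr\<^sub>e (- 1 - b) * J t)"
      by (intro add_mono mult_left_mono mult_right_mono exps) auto
    finally show "g t * V t powr\<^sub>e (1 - p) \<le> k t + ennreal b * (\<rho> t * V t powr\<^sub>e (- 1 - b) * J t)"
      by simp
  qed
  also have "\<dots> = (\<integral>\<^sup>+t. k t \<partial>halfline)
      + ennreal b * (\<integral>\<^sup>+t. \<rho> t * V t powr\<^sub>e (- 1 - b) * J t \<partial>halfline)"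
    by (simp add: nn_integral_add nn_integral_cmult)
  also have "(\<integral>\<^sup>+t. \<rho> t * V t powr\<^sub>e (- 1 - b) * J t \<partial>halfline)
      = (\<integral>\<^sup>+s. k s * V s powr\<^sub>e b * tail_integral (\<lambda>t. \<rho> t * V t powr\<^sub>e (- 1 - b)) s \<partial>halfline)"
    unfolding J_def by (rule nn_integral_mult_integral0) measurable
  also have "ennreal b * \<dots>
      = (\<integral>\<^sup>+s. k s * V s powr\<^sub>e b * (ennreal b * tail_integral (\<lambda>t. \<rho> t * V t powr\<^sub>e (- 1 - b)) s) \<partial>halfline)"
    by (subst nn_integral_cmult[symmetric]) (auto intro!: nn_integral_cong simp: mult_ac)
  also have "\<dots> \<le> (\<integral>\<^sup>+s. k s * 1 \<partial>halfline)"
  proof (intro nn_integral_mono)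
    fix s
    have "k s * V s powr\<^sub>e b * (ennreal b * tail_integral (\<lambda>t. \<rho> t * V t powr\<^sub>e (- 1 - b)) s)
        \<le> k s * V s powr\<^sub>e b * V s powr\<^sub>e (- b)"
      by (intro mult_left_mono tail_integral_power_le b) auto
    also have "\<dots> \<le> k s * 1"
      unfolding mult.assoc by (intro mult_left_mono exps) auto
    finally show "k s * V s powr\<^sub>e b * (ennreal b * tail_integral (\<lambda>t. \<rho> t * V t powr\<^sub>e (- 1 - b)) s)
        \<le> k s * 1" .
  qed
  finally show ?thesis
    by (simp add: k_def mult_2 add_left_mono)
qed

text \<open>
  Integration of the derivative \<open>g\<close>: by Tonelli's theorem a mass of \<open>k\<close> at \<open>s < x\<close> enters
  \<open>\<integral>\<^sub>0\<^sup>x g\<close> with the factor \<open>V s powr b * (V s powr b + b \<integral>\<^sub>s\<^sup>x \<rho> V powr (b - 1))\<close>, and the bracket is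
  \<open>V x powr b\<close>.
\<close>

lemma integral0_Hardy_function_ge:
  fixes h :: "real \<Rightarrow> ennreal"
  defines "b \<equiv> (p - 1) / 2" and "k \<equiv> \<lambda>t. h t powr\<^sub>e p * v t"
  defines "g \<equiv> \<lambda>t. k t * V t powr\<^sub>e (2 * b)
    + ennreal b * (\<rho> t * V t powr\<^sub>e (b - 1) * integral0 (\<lambda>s. k s * V s powr\<^sub>e b) t)"
  assumes [measurable]: "h \<in> borel_measurable halfline"
  shows "integral0 (\<lambda>t. k t * V t powr\<^sub>e b) x * V x powr\<^sub>e b \<le> integral0 g x"
proof -
  have b: "0 < b"
    using p_gt_1 by (simp add: b_def)
  have [measurable]: "k \<in> borel_measurable halfline"
    unfolding k_def by measurable
  define J where "J = integral0 (\<lambda>s. k s * V s powr\<^sub>e b)"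
  have [measurable]: "J \<in> borel_measurable halfline"
    unfolding J_def by measurable
  let ?r = "\<lambda>t. \<rho> t * V t powr\<^sub>e (b - 1) * indicator {..<x} t"
  have "J x * V x powr\<^sub>e b = (\<integral>\<^sup>+s. k s * V s powr\<^sub>e b * indicator {..<x} s * V x powr\<^sub>e b \<partial>halfline)"
    unfolding J_def integral0_halfline[of "\<lambda>s. k s * V s powr\<^sub>e b"]
    by (rule nn_integral_multc[symmetric]) measurable
  also have "\<dots> \<le> (\<integral>\<^sup>+s. k s * V s powr\<^sub>e (2 * b) * indicator {..<x} s
      + ennreal b * (k s * V s powr\<^sub>e b * tail_integral ?r s) \<partial>halfline)"
  proof (intro nn_integral_mono)
    fix s
    show "k s * V s powr\<^sub>e b * indicator {..<x} s * V x powr\<^sub>e b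
        \<le> k s * V s powr\<^sub>e (2 * b) * indicator {..<x} s
          + ennreal b * (k s * V s powr\<^sub>e b * tail_integral ?r s)"
    proof (cases "s < x")
      case True
      have "k s * V s powr\<^sub>e b * V x powr\<^sub>e b
          \<le> k s * V s powr\<^sub>e b * (V s powr\<^sub>e b + ennreal b * tail_integral ?r s)"
        by (intro mult_left_mono power_le_tail_integral b) auto
      also have "\<dots> = k s * V s powr\<^sub>e (2 * b) + ennreal b * (k s * V s powr\<^sub>e b * tail_integral ?r s)"
        using ennpowr_add[OF b b, of "V s"] by (simp add: distrib_left mult_ac)
      finally show ?thesis
        using True by simp
    qed simp
  qed
  also have "\<dots> = (\<integral>\<^sup>+s. k s * V s powr\<^sub>e (2 * b) * indicator {..<x} s \<partial>halfline)
      + ennreal b * (\<integral>\<^sup>+s. k s * V s powr\<^sub>e b * tail_integral ?r s \<partial>halfline)"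
    by (simp add: nn_integral_add nn_integral_cmult)
  also have "(\<integral>\<^sup>+s. k s * V s powr\<^sub>e b * tail_integral ?r s \<partial>halfline)
      = (\<integral>\<^sup>+t. ?r t * J t \<partial>halfline)"
    unfolding J_def by (rule nn_integral_mult_integral0[symmetric]) measurable
  also have "(\<integral>\<^sup>+s. k s * V s powr\<^sub>e (2 * b) * indicator {..<x} s \<partial>halfline)
      + ennreal b * (\<integral>\<^sup>+t. ?r t * J t \<partial>halfline)
      = (\<integral>\<^sup>+s. k s * V s powr\<^sub>e (2 * b) * indicator {..<x} s + ennreal b * (?r s * J s) \<partial>halfline)"
    by (simp add: nn_integral_add nn_integral_cmult)
  also have "\<dots> = integral0 g x"
    unfolding integral0_halfline[of g]
    by (intro nn_integral_cong) (simp add: g_def J_def split: split_indicator)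
  finally show ?thesis
    by (simp add: J_def)
qed

text \<open>
  Where \<open>V\<close> vanishes, \<open>\<rho>\<close> vanishes and hence \<open>v = \<infinity>\<close>, almost everywhere; a
  finite integral then forces \<open>h = 0\<close>.
\<close>

lemma null_where_primitive_null:
  assumes [measurable]: "h \<in> borel_measurable halfline"
    and fin: "(\<integral>\<^sup>+t. h t powr\<^sub>e p * v t \<partial>halfline) < \<infinity>"
  shows "AE t in halfline. V t = 0 \<longrightarrow> h t = 0"
proof -
  have "AE t in halfline. h t powr\<^sub>e p * v t \<noteq> \<infinity>"
    using fin by (intro nn_integral_noteq_infinite) auto
  then show ?thesis
    using density_null_where_primitive_null weight_pos
  proof eventually_elim
    case (elim t)
    then show ?case
      using p_gt_1
      by (cases "v t" rule: ennreal_trichotomy; cases "h t" rule: ennreal_trichotomy)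
         (auto simp: \<rho>_def dual_exponent ennpowr_ennreal ennreal_mult_top)
  qed
qed

text \<open>
  Integrated over \<open>(0,x)\<close> and optimised over \<open>\<kappa>\<close>, this gives Hoelder's inequality up to a constant.
  With the threshold
  \<open>z = \<kappa> \<rho> V powr (- 1/2)\<close> either \<open>h \<le> z\<close>, or \<open>h = h powr p * h powr (1 - p) \<le> h powr p * z powr (1 - p)\<close>.
  The exponent of \<open>V\<close> in the first summand is written \<open>1/2 - 1\<close> because \<open>\<rho> V powr (1/2 - 1)\<close> is
  the derivative of \<open>2 V powr (1/2)\<close>.
\<close>

lemma pointwise_Hoelder_split:
  assumes "0 < \<kappa>" and pos: "0 < v t" and "V t = 0 \<longrightarrow> h t = 0"
  shows "h t \<le> ennreal \<kappa> * (\<rho> t * V t powr\<^sub>e (1 / 2 - 1))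
    + ennreal (\<kappa> powr (1 - p)) * (h t powr\<^sub>e p * v t * V t powr\<^sub>e ((p - 1) / 2))"
proof -
  consider "h t = 0" | "h t \<noteq> 0" "V t \<noteq> 0" "h t = top \<or> v t = top"
    | r s y where "0 < r" "0 < s" "0 < y" "h t = ennreal r" "v t = ennreal s" "V t = ennreal y"
    using assms V_less_top[of t]
    by (cases "v t" rule: ennreal_trichotomy; cases "h t" rule: ennreal_trichotomy;
        cases "V t" rule: ennreal_trichotomy) auto
  then show ?thesis
  proof cases
    case 1
    then show ?thesis by simp
  next
    case 2
    have "h t powr\<^sub>e p * v t = top"
      using 2 pos p_gt_1 ennpowr_pos[of p "h t"] by (auto simp: ennreal_mult_top ennreal_top_mult)
    then have "h t powr\<^sub>e p * v t * V t powr\<^sub>e ((p - 1) / 2) = top"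
      using 2 p_gt_1 ennpowr_pos[of "(p - 1) / 2" "V t"] by (auto simp: ennreal_top_mult)
    then show ?thesis
      using \<open>0 < \<kappa>\<close> by (simp add: ennreal_mult_top)
  next
    case 3
    define z where "z = \<kappa> * (s powr - (1 / (p - 1)) * y powr (1 / 2 - 1))"
    have z: "0 < z"
      using 3 \<open>0 < \<kappa>\<close> by (simp add: z_def)
    have e: "- (1 / (p - 1)) * (1 - p) = 1" "(1 / 2 - 1) * (1 - p) = (p - 1) / 2"
      using p_gt_1 by (simp_all add: field_simps)
    have "z powr (1 - p) = \<kappa> powr (1 - p) * (s * y powr ((p - 1) / 2))"
      using 3 \<open>0 < \<kappa>\<close> unfolding z_def by (simp only: powr_mult powr_powr e) simp
    then have alt: "\<kappa> powr (1 - p) * (r powr p * s * y powr ((p - 1) / 2)) = r powr p * z powr (1 - p)"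
      by (simp add: mult_ac)
    have "r \<le> z + r powr p * z powr (1 - p)"
    proof (cases "r \<le> z")
      case True
      then show ?thesis using z 3 by (simp add: add_increasing2)
    next
      case False
      have "r = r powr p * r powr (1 - p)"
        using 3 by (simp flip: powr_add)
      also have "\<dots> \<le> r powr p * z powr (1 - p)"
        using False z p_gt_1 by (intro mult_left_mono powr_mono2') auto
      finally show ?thesis using z by simp
    qed
    then have "ennreal r \<le> ennreal (z + \<kappa> powr (1 - p) * (r powr p * s * y powr ((p - 1) / 2)))"
      unfolding alt by (rule ennreal_leI)
    also have "\<dots> = ennreal \<kappa> * (\<rho> t * V t powr\<^sub>e (1 / 2 - 1))
    + ennreal (\<kappa> powr (1 - p)) * (h t powr\<^sub>e p * v t * V t powr\<^sub>e ((p - 1) / 2))"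
      using 3 z \<open>0 < \<kappa>\<close>
      by (simp add: z_def \<rho>_def dual_exponent ennpowr_ennreal flip: ennreal_mult ennreal_plus)
    finally show ?thesis
      using 3 by simp
  qed
qed

lemma integral0_le_split:
  assumes [measurable]: "h \<in> borel_measurable halfline"
    and fin: "(\<integral>\<^sup>+t. h t powr\<^sub>e p * v t \<partial>halfline) < \<infinity>" and "0 < \<kappa>"
  shows "integral0 h x \<le> ennreal \<kappa> * (2 * V x powr\<^sub>e (1 / 2))
    + ennreal (\<kappa> powr (1 - p)) * integral0 (\<lambda>t. h t powr\<^sub>e p * v t * V t powr\<^sub>e ((p - 1) / 2)) x"
proof -
  let ?f1 = "\<lambda>t. \<rho> t * V t powr\<^sub>e (1 / 2 - 1)"
  let ?f2 = "\<lambda>t. h t powr\<^sub>e p * v t * V t powr\<^sub>e ((p - 1) / 2)"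
  have "integral0 h x \<le> (\<integral>\<^sup>+t. ennreal \<kappa> * (?f1 t * indicator {..<x} t)
      + ennreal (\<kappa> powr (1 - p)) * (?f2 t * indicator {..<x} t) \<partial>halfline)"
    unfolding integral0_halfline[of h]
  proof (rule nn_integral_mono_AE, use weight_pos null_where_primitive_null[OF assms(1) fin] in eventually_elim)
    fix t assume "0 < v t" "V t = 0 \<longrightarrow> h t = 0"
    from pointwise_Hoelder_split[where h = h and t = t, OF \<open>0 < \<kappa>\<close> this]
    show "h t * indicator {..<x} t \<le> ennreal \<kappa> * (?f1 t * indicator {..<x} t)
      + ennreal (\<kappa> powr (1 - p)) * (?f2 t * indicator {..<x} t)"
      by (simp split: split_indicator)
  qed
  also have "\<dots> = ennreal \<kappa> * integral0 ?f1 x + ennreal (\<kappa> powr (1 - p)) * integral0 ?f2 x"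
    unfolding integral0_halfline[of ?f1] integral0_halfline[of ?f2]
    by (simp add: nn_integral_add nn_integral_cmult)
  also have "integral0 ?f1 x = 2 * V x powr\<^sub>e (1 / 2)"
  proof -
    have "2 * V x powr\<^sub>e (1 / 2) = (2 * ennreal (1 / 2)) * integral0 ?f1 x"
      using integral0_power[of "1 / 2" x] by (simp add: mult.assoc)
    also have "2 * ennreal (1 / 2) = 1"
      using ennreal_mult[of 2 "1 / 2"] by simp
    finally show ?thesis by simp
  qed
  finally show ?thesis .
qed

text \<open>
  Degenerate cases apart, this is the split with the \<open>\<kappa>\<close> that balances its two summands. If \<open>V x\<close> or the integral on the
  right vanishes, then \<open>h = 0\<close> almost everywhere on \<open>(0,x)\<close>.
\<close>

lemma integral0_le_Hardy:
  assumes [measurable]: "h \<in> borel_measurable halfline"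
    and fin: "(\<integral>\<^sup>+t. h t powr\<^sub>e p * v t \<partial>halfline) < \<infinity>"
  shows "integral0 h x \<le>
    3 * (integral0 (\<lambda>t. h t powr\<^sub>e p * v t * V t powr\<^sub>e ((p - 1) / 2)) x * V x powr\<^sub>e ((p - 1) / 2)) powr\<^sub>e (1 / p)"
proof -
  let ?f = "\<lambda>t. h t powr\<^sub>e p * v t * V t powr\<^sub>e ((p - 1) / 2)"
  note null = null_where_primitive_null[OF assms(1) fin]
  have null_integral: "integral0 h x = 0" if "AE t in halfline. t < x \<longrightarrow> h t = 0"
  proof -
    have "integral0 h x = (\<integral>\<^sup>+t. 0 \<partial>halfline)"
      unfolding integral0_halfline
      by (intro nn_integral_cong_AE eventually_mono[OF that]) (simp split: split_indicator)
    then show ?thesis by simp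
  qed
  consider "V x = 0" | "integral0 ?f x = 0" | "V x \<noteq> 0" "integral0 ?f x = top"
    | a y where "0 < a" "0 < y" "integral0 ?f x = ennreal a" "V x = ennreal y"
    using V_less_top[of x]
    by (cases "integral0 ?f x" rule: ennreal_trichotomy; cases "V x" rule: ennreal_trichotomy) auto
  then show ?thesis
  proof cases
    case 1
    have "AE t in halfline. t < x \<longrightarrow> h t = 0"
      using null by eventually_elim (use 1 V_mono[of _ x] in force)
    then show ?thesis by (simp add: null_integral)
  next
    case 2
    then have "AE t in halfline. ?f t * indicator {..<x} t = 0"
      unfolding integral0_halfline[of ?f] by (subst (asm) nn_integral_0_iff_AE) measurable
    then have "AE t in halfline. t < x \<longrightarrow> h t = 0"
      using null weight_pos
    proof eventually_elim
      case (elim t)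
      then show ?case
        using p_gt_1 ennpowr_pos[of p "h t"] ennpowr_pos[of "(p - 1) / 2" "V t"] by (cases "h t = 0") auto
    qed
    then show ?thesis by (simp add: null_integral)
  next
    case 3
    then show ?thesis
      using p_gt_1 ennpowr_pos[of "(p - 1) / 2" "V x"] by (simp add: ennreal_top_mult ennreal_mult_top)
  next
    case 4
    (* this value makes the two summands of the split comparable *)
    define \<kappa> where "\<kappa> = (a * y powr (- (1 / 2))) powr (1 / p)"
    have \<kappa>: "0 < \<kappa>"
      using 4 by (simp add: \<kappa>_def)
    have "\<kappa> powr - p = a powr - 1 * y powr (1 / 2)"
      using 4 p_gt_1 by (simp add: \<kappa>_def powr_powr powr_mult)
    then have "\<kappa> powr (1 - p) * a = \<kappa> * y powr (1 / 2)"
      using 4 \<kappa> by (simp add: powr_diff powr_minus field_simps)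
    moreover have "\<kappa> * y powr (1 / 2) = (a * y powr ((p - 1) / 2)) powr (1 / p)"
    proof -
      have "- (1 / 2) * (1 / p) + 1 / 2 = (p - 1) / 2 * (1 / p)"
        using p_gt_1 by (simp add: field_simps)
      then show ?thesis
        using 4 by (simp add: \<kappa>_def powr_mult powr_powr mult.assoc flip: powr_add)
    qed
    ultimately have *: "\<kappa> * (2 * y powr (1 / 2)) + \<kappa> powr (1 - p) * a
        = 3 * (a * y powr ((p - 1) / 2)) powr (1 / p)"
      by simp
    have "integral0 h x \<le> ennreal \<kappa> * (2 * V x powr\<^sub>e (1 / 2)) + ennreal (\<kappa> powr (1 - p)) * integral0 ?f x"
      by (rule integral0_le_split[OF assms(1) fin \<kappa>])
    also have "\<dots> = ennreal (\<kappa> * (2 * y powr (1 / 2)) + \<kappa> powr (1 - p) * a)"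
      using 4 \<kappa> by (simp add: ennpowr_ennreal flip: ennreal_numeral ennreal_mult ennreal_plus)
    also have "\<dots> = 3 * (integral0 ?f x * V x powr\<^sub>e ((p - 1) / 2)) powr\<^sub>e (1 / p)"
      unfolding * using 4 by (simp add: ennpowr_ennreal flip: ennreal_numeral ennreal_mult)
    finally show ?thesis .
  qed
qed

text \<open>
  The first of the two problems without \<open>T\<close>, solved by the function \<open>g\<close> of \<open>integral0_le_tail_function\<close>.
\<close>

lemma ex_function_for_root:
  assumes [measurable]: "h \<in> borel_measurable halfline"
    and fin: "(\<integral>\<^sup>+t. h t * V t powr\<^sub>e (1 - p) \<partial>halfline) < \<infinity>"
  obtains g where "g \<in> borel_measurable halfline"
    "(\<integral>\<^sup>+t. g t powr\<^sub>e p * v t \<partial>halfline) \<le> (\<integral>\<^sup>+t. h t * V t powr\<^sub>e (1 - p) \<partial>halfline)"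
    "\<And>x. integral0 h x powr\<^sub>e (1 / p) \<le> ennreal (p powr (1 / p)) * integral0 g x"
proof -
  let ?g = "\<lambda>t. \<rho> t * tail_integral (\<lambda>s. h s * V s powr\<^sub>e (- p)) t powr\<^sub>e (1 / p)"
  have "integral0 h x powr\<^sub>e (1 / p) \<le> ennreal (p powr (1 / p)) * integral0 ?g x" for x
  proof -
    have "integral0 h x powr\<^sub>e (1 / p) \<le> (ennreal p * integral0 ?g x powr\<^sub>e p) powr\<^sub>e (1 / p)"
      using p_gt_1 by (intro ennpowr_mono integral0_le_tail_function[OF assms]) simp
    also have "\<dots> = ennreal (p powr (1 / p)) * integral0 ?g x"
      using p_gt_1 by (simp add: ennpowr_mult ennpowr_ennpowr ennpowr_ennreal)
    finally show ?thesis .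
  qed
  then show ?thesis
    by (intro that[of ?g] integral_bound_by_tail_function) measurable
qed

text \<open>
  The second problem without \<open>T\<close>, solved by the function \<open>g\<close> of \<open>integral0_Hardy_function_ge\<close>.
\<close>

lemma ex_function_for_power:
  assumes [measurable]: "h \<in> borel_measurable halfline"
    and fin: "(\<integral>\<^sup>+t. h t powr\<^sub>e p * v t \<partial>halfline) < \<infinity>"
  obtains g where "g \<in> borel_measurable halfline"
    "(\<integral>\<^sup>+t. g t * V t powr\<^sub>e (1 - p) \<partial>halfline) \<le> 2 * (\<integral>\<^sup>+t. h t powr\<^sub>e p * v t \<partial>halfline)"
    "\<And>x. integral0 h x \<le> 3 * integral0 g x powr\<^sub>e (1 / p)"
proof -
  define b where "b = (p - 1) / 2"
  let ?k = "\<lambda>t. h t powr\<^sub>e p * v t"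
  let ?g = "\<lambda>t. ?k t * V t powr\<^sub>e (2 * b)
    + ennreal b * (\<rho> t * V t powr\<^sub>e (b - 1) * integral0 (\<lambda>s. ?k s * V s powr\<^sub>e b) t)"
  have "integral0 h x \<le> 3 * integral0 ?g x powr\<^sub>e (1 / p)" for x
  proof -
    have "integral0 h x \<le> 3 * (integral0 (\<lambda>t. ?k t * V t powr\<^sub>e b) x * V x powr\<^sub>e b) powr\<^sub>e (1 / p)"
      unfolding b_def by (rule integral0_le_Hardy[OF assms])
    also have "\<dots> \<le> 3 * integral0 ?g x powr\<^sub>e (1 / p)"
      unfolding b_def using p_gt_1
      by (intro mult_left_mono ennpowr_mono integral0_Hardy_function_ge) auto
    finally show ?thesis .
  qed
  moreover have "(\<integral>\<^sup>+t. ?g t * V t powr\<^sub>e (1 - p) \<partial>halfline)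
      \<le> 2 * (\<integral>\<^sup>+t. h t powr\<^sub>e p * v t \<partial>halfline)"
    unfolding b_def by (rule integral_bound_by_Hardy_function[OF assms(1)])
  moreover have "?g \<in> borel_measurable halfline"
    by measurable
  ultimately show ?thesis
    using that[of ?g] by blast
qed

lemma Phi_power: "Phi p v x powr\<^sub>e (1 - 2 * p) = V x powr\<^sub>e (1 - p)"
proof -
  have "1 / (conj_exp p + 1) * (1 - 2 * p) = 1 - p"
    using p_gt_1 by (simp add: conj_exp_def field_simps)
  then show ?thesis
    by (simp only: Phi_def ennpowr_ennpowr \<rho>_def[abs_def])
qed

end

section \<open>The equivalence\<close>

lemma wnorm_inf_le_iff:
  assumes [measurable]: "f \<in> borel_measurable halfline" "\<omega> \<in> borel_measurable halfline"
  shows "wnorm_inf \<omega> f \<le> B \<longleftrightarrow> (AE x in halfline. f x * \<omega> x \<le> B)"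
proof
  assume "wnorm_inf \<omega> f \<le> B"
  then show "AE x in halfline. f x * \<omega> x \<le> B"
    using esssup_AE[of "\<lambda>x. f x * \<omega> x" halfline] unfolding wnorm_inf_def
    by (auto elim!: eventually_mono intro: order_trans)
next
  assume "AE x in halfline. f x * \<omega> x \<le> B"
  then show "wnorm_inf \<omega> f \<le> B"
    unfolding wnorm_inf_def by (intro esssup_I) auto
qed

lemma wnorm_inf_power_le_iff:
  assumes "0 < p" "0 < C" and [measurable]: "f \<in> borel_measurable halfline" "w \<in> borel_measurable halfline"
  shows "wnorm_inf (\<lambda>x. w x powr\<^sub>e p) (\<lambda>x. f x powr\<^sub>e p) \<le> ennreal (C powr p) * N
    \<longleftrightarrow> (AE x in halfline. f x * w x \<le> ennreal C * N powr\<^sub>e (1 / p))"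
proof -
  have "ennreal (C powr p) * N = (ennreal C * N powr\<^sub>e (1 / p)) powr\<^sub>e p"
    using assms by (simp add: ennpowr_mult ennpowr_ennpowr ennpowr_ennreal)
  then show ?thesis
    using assms
    by (subst wnorm_inf_le_iff) (simp_all add: ennpowr_mult[symmetric] ennpowr_le_iff)
qed

text \<open>
  The constant \<open>c\<close> is fixed before \<open>F\<close>, \<open>G\<close> and \<open>a\<close>: the inequalities for \<open>T\<close> hold with a constant
  independent of \<open>h\<close>, and so must everything derived from them.
\<close>

lemma monotone_quasilinear_le:
  assumes "monotone_quasilinear T"
  obtains c where "0 < c" and
    "\<And>F G a. F \<in> borel_measurable halfline \<Longrightarrow> G \<in> borel_measurable halfline \<Longrightarrow> 0 \<le> a
      \<Longrightarrow> (\<And>x. F x \<le> ennreal a * G x)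
      \<Longrightarrow> AE x in halfline. T F x \<le> ennreal (c * a) * T G x"
proof -
  have hom: "AE x in halfline. T (\<lambda>y. ennreal l * f y) x = ennreal l * T f x"
    if "0 \<le> l" "f \<in> Mplus" for l f
    using assms that by (simp add: monotone_quasilinear_def)
  have "\<exists>c::real. c > 0 \<and> (\<forall>f\<in>Mplus. \<forall>g\<in>Mplus. (AE x in halfline. f x \<le> g x) \<longrightarrow>
      (AE x in halfline. T f x \<le> ennreal c * T g x))"
    using assms unfolding monotone_quasilinear_def by (elim conjE)
  then obtain c :: real where c: "0 < c" and mono: "\<forall>f\<in>Mplus. \<forall>g\<in>Mplus.
      (AE x in halfline. f x \<le> g x) \<longrightarrow> (AE x in halfline. T f x \<le> ennreal c * T g x)"
    by (elim exE conjE)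
  have "AE x in halfline. T F x \<le> ennreal (c * a) * T G x"
    if [measurable]: "F \<in> borel_measurable halfline" "G \<in> borel_measurable halfline"
      and a: "0 \<le> a" and le: "\<And>x. F x \<le> ennreal a * G x" for F G a
  proof -
    have G: "G \<in> Mplus"
      by (simp add: Mplus_def)
    have "AE x in halfline. T F x \<le> ennreal c * T (\<lambda>y. ennreal a * G y) x"
      using le by (intro mono[rule_format]) (simp_all add: Mplus_def)
    then show ?thesis
      using hom[OF a G]
      by eventually_elim (use a c in \<open>simp add: ennreal_mult mult.assoc\<close>)
  qed
  with c show ?thesis
    using that by blast
qed

lemma AE_le_through_transfer:
  assumes "AE x in M. f x \<le> ennreal a * g x" "AE x in M. g x * w x \<le> ennreal C * n"
    and "n \<le> ennreal d * N" and "0 < a" "0 < C" "0 < d"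
  shows "AE x in M. f x * w x \<le> ennreal (a * C * d) * N"
  using assms(1,2)
proof eventually_elim
  case (elim x)
  have "f x * w x \<le> ennreal a * g x * w x"
    by (intro mult_right_mono elim) simp
  also have "\<dots> \<le> ennreal a * (ennreal C * n)"
    unfolding mult.assoc by (intro mult_left_mono elim) simp
  also have "\<dots> \<le> ennreal a * (ennreal C * (ennreal d * N))"
    by (intro mult_left_mono assms(3)) simp_all
  also have "\<dots> = ennreal (a * C * d) * N"
    using assms(4-) by (simp add: ennreal_mult mult.assoc)
  finally show ?case .
qed

theorem theorem1p7:
  fixes p :: real
    and T :: "(real \<Rightarrow> ennreal) \<Rightarrow> real \<Rightarrow> ennreal"
    and v w :: "real \<Rightarrow> ennreal"
  assumes "1 < p"
    and "monotone_quasilinear T"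
    and "w \<in> weights"
    and "v \<in> weights"
    and "\<And>x. x > 0 \<Longrightarrow> integral0 (\<lambda>t. v t powr\<^sub>e (1 - conj_exp p)) x < \<infinity>"
  shows
    "(\<exists>C::real. C > 0 \<and> (\<forall>h\<in>Mplus.
        wnorm_inf w (T (\<lambda>x. integral0 h x)) \<le> ennreal C * wnorm p v h))
     \<longleftrightarrow>
     (\<exists>C::real. C > 0 \<and> (\<forall>h\<in>Mplus.
        wnorm_inf (\<lambda>x. w x powr\<^sub>e p)
          (\<lambda>x. (T (\<lambda>y. (integral0 h y) powr\<^sub>e (1 / p)) x) powr\<^sub>e p)
        \<le> ennreal (C powr p) * wnorm 1 (\<lambda>x. Phi p v x powr\<^sub>e (1 - 2 * p)) h))"
    (is "(\<exists>C>0. \<forall>h\<in>Mplus. ?lhs C h) \<longleftrightarrow> (\<exists>C>0. \<forall>h\<in>Mplus. ?rhs C h)")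
proof -
  interpret hardy_weight p v
    using assms by unfold_locales (auto simp: weights_def Mplus_def)
  have p: "0 < p" using p_gt_1 by simp
  have [measurable]: "w \<in> borel_measurable halfline"
    using assms(3) by (simp add: weights_def Mplus_def)
  have T [measurable]: "T f \<in> borel_measurable halfline" if "f \<in> borel_measurable halfline" for f
    using assms(2) that by (simp add: monotone_quasilinear_def Mplus_def)
  obtain c where "0 < c" and T_le:
    "\<And>F G a. F \<in> borel_measurable halfline \<Longrightarrow> G \<in> borel_measurable halfline \<Longrightarrow> 0 \<le> a
      \<Longrightarrow> (\<And>x. F x \<le> ennreal a * G x)
      \<Longrightarrow> AE x in halfline. T F x \<le> ennreal (c * a) * T G x"
    using monotone_quasilinear_le[OF assms(2)] by blast
  define A where "A h = (\<integral>\<^sup>+t. h t powr\<^sub>e p * v t \<partial>halfline)" for h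
  define B where "B h = (\<integral>\<^sup>+t. h t * V t powr\<^sub>e (1 - p) \<partial>halfline)" for h
  have lhs: "?lhs C h \<longleftrightarrow> (AE x in halfline. T (integral0 h) x * w x \<le> ennreal C * A h powr\<^sub>e (1 / p))"
    if "h \<in> Mplus" for C h
    using that by (subst wnorm_inf_le_iff) (simp_all add: Mplus_def wnorm_def A_def)
  have rhs: "?rhs C h \<longleftrightarrow>
      (AE x in halfline. T (\<lambda>y. integral0 h y powr\<^sub>e (1 / p)) x * w x \<le> ennreal C * B h powr\<^sub>e (1 / p))"
    if "h \<in> Mplus" "0 < C" for C h
  proof -
    have [measurable]: "h \<in> borel_measurable halfline"
      using that(1) by (simp add: Mplus_def)
    have "wnorm 1 (\<lambda>x. Phi p v x powr\<^sub>e (1 - 2 * p)) h = B h"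
      by (simp add: wnorm_def B_def Phi_power)
    then show ?thesis
      by (simp add: wnorm_inf_power_le_iff[OF p that(2)])
  qed
  show ?thesis
  proof (intro iffI; elim exE conjE)
    fix C :: real assume C: "0 < C" and hyp: "\<forall>h\<in>Mplus. ?lhs C h"
    (* the factors c, p powr (1 / p) and 1 come from T, from the pointwise bound for the root and
       from the comparison of the norms of g and h *)
    define C' where "C' = c * p powr (1 / p) * C * 1"
    have "0 < C'"
      using C \<open>0 < c\<close> p by (simp add: C'_def)
    moreover have "?rhs C' h" if h: "h \<in> Mplus" for h
    proof (cases "B h = \<infinity>")
      case True
      then show ?thesis
        using p \<open>0 < C'\<close> by (simp add: rhs[OF h] ennreal_mult_top)
    next
      case False
      have hm [measurable]: "h \<in> borel_measurable halfline"
        using h by (simp add: Mplus_def)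
      have fin: "B h < \<infinity>"
        using False by (simp add: less_top)
      obtain g where g [measurable]: "g \<in> borel_measurable halfline" and AB: "A g \<le> B h"
        and le: "\<And>x. integral0 h x powr\<^sub>e (1 / p) \<le> ennreal (p powr (1 / p)) * integral0 g x"
        by (rule ex_function_for_root[OF hm fin[unfolded B_def], folded A_def B_def]) (rule that)
      have "AE x in halfline. T (\<lambda>y. integral0 h y powr\<^sub>e (1 / p)) x
          \<le> ennreal (c * p powr (1 / p)) * T (integral0 g) x"
        by (rule T_le[OF _ _ _ le]) auto
      moreover have "AE x in halfline. T (integral0 g) x * w x \<le> ennreal C * A g powr\<^sub>e (1 / p)"
        using hyp g lhs[of g C] by (simp add: Mplus_def)
      moreover have "A g powr\<^sub>e (1 / p) \<le> ennreal 1 * B h powr\<^sub>e (1 / p)"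
        using ennpowr_mono[OF _ AB, of "1 / p"] p by simp
      ultimately have "AE x in halfline. T (\<lambda>y. integral0 h y powr\<^sub>e (1 / p)) x * w x
          \<le> ennreal C' * B h powr\<^sub>e (1 / p)"
        unfolding C'_def by (rule AE_le_through_transfer) (use C \<open>0 < c\<close> p in auto)
      then show ?thesis
        unfolding rhs[OF h \<open>0 < C'\<close>] .
    qed
    ultimately show "\<exists>C>0. \<forall>h\<in>Mplus. ?rhs C h" by blast
  next
    fix C :: real assume C: "0 < C" and hyp: "\<forall>h\<in>Mplus. ?rhs C h"
    define C' where "C' = c * 3 * C * 2 powr (1 / p)"
    have "0 < C'"
      using C \<open>0 < c\<close> by (simp add: C'_def)
    moreover have "?lhs C' h" if h: "h \<in> Mplus" for h
    proof (cases "A h = \<infinity>")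
      case True
      then show ?thesis
        using p \<open>0 < C'\<close> by (simp add: lhs[OF h] ennreal_mult_top)
    next
      case False
      have hm [measurable]: "h \<in> borel_measurable halfline"
        using h by (simp add: Mplus_def)
      have fin: "A h < \<infinity>"
        using False by (simp add: less_top)
      obtain g where g [measurable]: "g \<in> borel_measurable halfline" and AB: "B g \<le> 2 * A h"
        and le: "\<And>x. integral0 h x \<le> 3 * integral0 g x powr\<^sub>e (1 / p)"
        by (rule ex_function_for_power[OF hm fin[unfolded A_def], folded A_def B_def]) (rule that)
      have "AE x in halfline. T (integral0 h) x
          \<le> ennreal (c * 3) * T (\<lambda>y. integral0 g y powr\<^sub>e (1 / p)) x"
        using le by (intro T_le) auto
      moreover have "AE x in halfline. T (\<lambda>y. integral0 g y powr\<^sub>e (1 / p)) x * w x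
          \<le> ennreal C * B g powr\<^sub>e (1 / p)"
        using hyp g rhs[of g C] C by (simp add: Mplus_def)
      moreover have "B g powr\<^sub>e (1 / p) \<le> ennreal (2 powr (1 / p)) * A h powr\<^sub>e (1 / p)"
        using ennpowr_mono[OF _ AB, of "1 / p"] p
        by (simp add: ennpowr_mult ennpowr_ennreal[of 2, simplified])
      ultimately have "AE x in halfline. T (integral0 h) x * w x \<le> ennreal C' * A h powr\<^sub>e (1 / p)"
        unfolding C'_def by (rule AE_le_through_transfer) (use C \<open>0 < c\<close> in auto)
      then show ?thesis
        unfolding lhs[OF h] .
    qed
    ultimately show "\<exists>C>0. \<forall>h\<in>Mplus. ?lhs C h" by blast
  qed
qed

end
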